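(* Let $V\in\mathbb{R}^{n\times n}$ be a nonsingular covariance matrix (symmetric positive definite) of $n$ risky assets, $\eta=\operatorname{diag}(V)$, and append a risk-free asset as the $(n+1)$th asset. For $\sigma\ge0$ let $\widetilde q_{\mathrm{dr}}(\sigma)$ be the optimal value of $$\max_{\widetilde{\mathbf w}}\ \widetilde q(\widetilde{\mathbf w})=\tfrac12\widetilde{\mathbf w}^\top\widetilde D\widetilde{\mathbf w}\quad\text{s.t.}\quad\mathbf 1_{n+1}^\top\widetilde{\mathbf w}=1,\ \ \mathbf w^\top V\mathbf w=\sigma^2,\qquad\widetilde{\mathbf w}=\begin{pmatrix}\mathbf w\\ w_0\end{pmatrix}\in\mathbb{R}^{n+1},\ \mathbf w\in\mathbb{R}^n,\ w_0\in\mathbb{R}.$$ Then $$\widetilde q_{\mathrm{dr}}(\sigma)=-\frac12\sigma^2+\frac{\sigma}{2}\sqrt{\eta^\top V^{-1}\eta}\qquad\text{for all }\sigma\ge0 .$$ In particular, the efficient DR frontier with a risk-free asset is a parabola and is strongly concave in $\sigma$.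
   Context: $\mathbf 1_m\in\mathbb{R}^m$ is the all-ones column vector and $\operatorname{diag}(V)$ is the column vector of diagonal entries of $V$. The covariance matrix of the $n+1$ assets is $\widetilde V=\begin{pmatrix}V&0\\0&0\end{pmatrix}$, and $$\widetilde D=\begin{pmatrix}\tfrac12(\eta\mathbf 1_n^\top+\mathbf 1_n\eta^\top)-V&\tfrac12\eta\\ \tfrac12\eta^\top&0\end{pmatrix} .$$ For $\mathbf 1_{n+1}^\top\widetilde{\mathbf w}=1$, $\tfrac12\widetilde{\mathbf w}^\top\widetilde D\widetilde{\mathbf w}$ is the diversification return of $\widetilde{\mathbf w}$ in the $(n+1)$-asset universe. A function $f$ is strongly concave on an interval if $f(x)+\frac m2x^2$ is concave there for some $m>0$. *)

theory Defs
  imports "HOL-Analysis.Analysis"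
begin

text \<open>The risky assets are indexed by the finite type \<^typ>\<open>'n\<close>. The enlarged universe is
  indexed by \<^typ>\<open>'n option\<close>: \<open>Some i\<close> is the risky asset \<open>i\<close>, \<open>None\<close> is the risk-free asset.\<close>

definition sym_pos_def :: "real^'n^'n \<Rightarrow> bool" where
  "sym_pos_def V \<longleftrightarrow> transpose V = V \<and> (\<forall>x. x \<noteq> 0 \<longrightarrow> x \<bullet> (V *v x) > 0)"

definition diag_vec :: "real^'n^'n \<Rightarrow> real^'n" where
  "diag_vec V = (\<chi> i. V $ i $ i)"

definition D_tilde :: "real^'n^'n \<Rightarrow> real^('n option)^('n option)" where
  "D_tilde V = (\<chi> i j. case (i, j) of
       (Some a, Some b) \<Rightarrow> (1/2) * (diag_vec V $ a + diag_vec V $ b) - V $ a $ b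
     | (Some a, None) \<Rightarrow> (1/2) * diag_vec V $ a
     | (None, Some b) \<Rightarrow> (1/2) * diag_vec V $ b
     | (None, None) \<Rightarrow> 0)"

definition risky_part :: "real^('n option) \<Rightarrow> real^'n" where
  "risky_part w = (\<chi> i. w $ Some i)"

definition q_tilde :: "real^'n^'n \<Rightarrow> real^('n option) \<Rightarrow> real" where
  "q_tilde V w = (1/2) * (w \<bullet> (D_tilde V *v w))"

definition feasible :: "real^'n^'n \<Rightarrow> real \<Rightarrow> (real^('n option)) set" where
  "feasible V \<sigma> = {w. vec 1 \<bullet> w = 1 \<and> risky_part w \<bullet> (V *v risky_part w) = \<sigma>\<^sup>2}"

text \<open>The supremum is the optimal value of the maximisation problem only when the maximum
  exists; its attainment is expressed separately by \<open>is_maximiser\<close>.\<close>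

definition q_dr :: "real^'n^'n \<Rightarrow> real \<Rightarrow> real" where
  "q_dr V \<sigma> = (SUP w\<in>feasible V \<sigma>. q_tilde V w)"

definition is_maximiser :: "real^'n^'n \<Rightarrow> real \<Rightarrow> real^('n option) \<Rightarrow> bool" where
  "is_maximiser V \<sigma> w \<longleftrightarrow>
     w \<in> feasible V \<sigma> \<and> (\<forall>u\<in>feasible V \<sigma>. q_tilde V u \<le> q_tilde V w)"

definition dr_frontier :: "real^'n^'n \<Rightarrow> (real \<times> real) set" where
  "dr_frontier V = {(\<sigma>, q_dr V \<sigma>) | \<sigma>. \<sigma> \<ge> 0}"

text \<open>As \<open>\<sigma>\<close> is a volatility, only the part of the parabola over the half-line
  \<open>\<sigma> \<ge> 0\<close> occurs.\<close>

definition is_parabola_over_nonneg :: "(real \<times> real) set \<Rightarrow> bool" where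
  "is_parabola_over_nonneg F \<longleftrightarrow>
     (\<exists>a b c. a \<noteq> 0 \<and> F = {(x, a * x\<^sup>2 + b * x + c) | x. x \<ge> 0})"

definition strongly_concave_on :: "real set \<Rightarrow> (real \<Rightarrow> real) \<Rightarrow> bool" where
  "strongly_concave_on S f \<longleftrightarrow> (\<exists>m>0. concave_on S (\<lambda>x. f x + m / 2 * x\<^sup>2))"

end

theory Submission imports Defs begin

text \<open>The budget constraint eliminates the risk-free weight and turns \<open>q_tilde\<close> into the linear
  functional \<open>(\<eta> \<bullet> w - \<sigma>\<^sup>2) / 2\<close> on the ellipsoid \<open>w \<bullet> V w = \<sigma>\<^sup>2\<close>. The Cauchy--Schwarz inequality
  in the inner product of \<open>V\<close>, applied to \<open>w\<close> and \<open>V\<^sup>-\<^sup>1 \<eta>\<close>, gives the maximum.\<close>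

lemma sum_UNIV_option:
  fixes f :: "'n::finite option \<Rightarrow> 'a::comm_monoid_add"
  shows "(\<Sum>i\<in>UNIV. f i) = f None + (\<Sum>i\<in>UNIV. f (Some i))"
  by (simp add: UNIV_option_conv sum.reindex)

lemma one_inner_option:
  fixes w :: "real^('n::finite option)"
  shows "1 \<bullet> w = w $ None + 1 \<bullet> risky_part w"
  by (simp add: inner_vec_def sum_UNIV_option risky_part_def)

text \<open>With \<open>e\<close> the extension of \<open>diag_vec V\<close> by 0 at
  \<open>None\<close>, the matrix \<open>D_tilde V\<close> is half the symmetrised outer product of
  \<open>e\<close> and the all-ones vector, minus \<open>V\<close> padded by zeros. Its quadratic
  form therefore splits into a product of two linear forms minus the variance. The budget constraint
  is not imposed yet.\<close>

lemma q_tilde_eq: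
  fixes V :: "real^'n^'n"
  shows "q_tilde V w = (1/2) * ((diag_vec V \<bullet> risky_part w) * (1 \<bullet> w)
           - risky_part w \<bullet> (V *v risky_part w))"
proof -
  define x d where "x = risky_part w" and "d = diag_vec V"
  have x: "w $ Some i = x $ i" for i by (simp add: x_def risky_part_def)
  have row_None: "(D_tilde V *v w) $ None = (1/2) * (d \<bullet> x)"
    by (simp add: matrix_vector_mult_def sum_UNIV_option D_tilde_def x d_def
        inner_vec_def sum_distrib_left mult.assoc)
  have row_Some: "(D_tilde V *v w) $ Some i
      = (1/2) * (d $ i * (1 \<bullet> w) + d \<bullet> x) - (V *v x) $ i" for i
  proof -
    have "(D_tilde V *v w) $ Some i
        = (1/2) * d $ i * w $ None
          + (\<Sum>j\<in>UNIV. (1/2) * d $ i * x $ j + (1/2) * (d $ j * x $ j) - V $ i $ j * x $ j)"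
      by (simp add: matrix_vector_mult_def sum_UNIV_option D_tilde_def x d_def algebra_simps)
    also have "\<dots> = (1/2) * d $ i * w $ None
        + ((1/2) * d $ i * (1 \<bullet> x) + (1/2) * (d \<bullet> x) - (V *v x) $ i)"
      by (simp only: sum.distrib sum_subtractf sum_distrib_left[symmetric])
         (simp add: inner_vec_def matrix_vector_mult_def)
    finally show ?thesis
      by (simp add: one_inner_option[of w] x_def[symmetric] algebra_simps)
  qed
  have "w \<bullet> (D_tilde V *v w) = w $ None * ((1/2) * (d \<bullet> x))
      + (\<Sum>i\<in>UNIV. (1/2) * (1 \<bullet> w) * (d $ i * x $ i) + (1/2) * (d \<bullet> x) * x $ i
          - x $ i * (V *v x) $ i)"
    by (simp add: inner_vec_def[of w] sum_UNIV_option row_None row_Some x algebra_simps)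
  also have "\<dots> = w $ None * ((1/2) * (d \<bullet> x))
      + ((1/2) * (1 \<bullet> w) * (d \<bullet> x) + (1/2) * (d \<bullet> x) * (1 \<bullet> x) - x \<bullet> (V *v x))"
    by (simp only: sum.distrib sum_subtractf sum_distrib_left[symmetric])
       (simp add: inner_vec_def)
  \<comment> \<open>As \<open>w $ None + 1 \<bullet> x = 1 \<bullet> w\<close>, the risk-free term
    and the second risky term together supply the other half of the product.\<close>
  also have "\<dots> = (d \<bullet> x) * (1 \<bullet> w) - x \<bullet> (V *v x)"
    by (simp add: one_inner_option[of w] x_def[symmetric] algebra_simps)
  finally show ?thesis by (simp add: q_tilde_def x_def d_def)
qed

text \<open>Positive definiteness makes the kernel of \<open>V\<close> trivial, so
  \<open>matrix_inv V\<close> is a genuine inverse.\<close>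

lemma sym_pos_def_mult_matrix_inv:
  assumes "sym_pos_def V"
  shows "V *v (matrix_inv V *v y) = y"
proof -
  have "x = 0" if "V *v x = 0" for x
    using assms that by (force simp: sym_pos_def_def)
  then have "invertible V"
    by (auto simp: invertible_left_inverse matrix_left_invertible_ker)
  then have "V ** matrix_inv V = mat 1"
    unfolding invertible_def matrix_inv_def by (rule someI2_ex) simp
  then show ?thesis
    by (simp add: matrix_vector_mul_assoc)
qed

text \<open>A diagonal entry is the value of the quadratic form at a coordinate vector, hence
  positive; an index exists because types are nonempty.\<close>

lemma diag_vec_nonzero:
  fixes V :: "real^'n^'n"
  assumes "sym_pos_def V"
  shows "diag_vec V \<noteq> 0"
proof
  fix i :: 'n
  assume "diag_vec V = 0"
  then have "V $ i $ i = 0" by (metis diag_vec_def vec_lambda_beta zero_index)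
  moreover have "axis i 1 \<bullet> (V *v axis i 1) = V $ i $ i"
    by (simp add: inner_axis' matrix_vector_mul_component inner_axis)
  moreover have "axis i (1::real) \<noteq> 0" by (simp add: axis_eq_0_iff)
  ultimately show False using assms unfolding sym_pos_def_def by (metis less_irrefl)
qed

lemma sym_pos_def_inner_commute:
  assumes "sym_pos_def V"
  shows "x \<bullet> (V *v y) = y \<bullet> (V *v x)"
  using assms by (metis dot_lmul_matrix inner_commute sym_pos_def_def transpose_matrix_vector)

lemma sym_pos_def_nonneg:
  assumes "sym_pos_def V"
  shows "0 \<le> x \<bullet> (V *v x)"
  using assms by (cases "x = 0") (auto simp: sym_pos_def_def intro: less_imp_le)

text \<open>Writing \<open>u\<close> for the preimage of \<open>diag_vec V\<close> under
  \<open>V\<close>, the number is the squared \<open>V\<close>-norm of \<open>u\<close>. Its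
  positivity permits division by its square root when a maximiser is built.\<close>

lemma matrix_inv_diag_pos:
  assumes "sym_pos_def V"
  shows "0 < diag_vec V \<bullet> (matrix_inv V *v diag_vec V)"
proof -
  let ?u = "matrix_inv V *v diag_vec V"
  have "V *v ?u = diag_vec V" by (rule sym_pos_def_mult_matrix_inv[OF assms])
  moreover from this have "?u \<noteq> 0"
    using diag_vec_nonzero[OF assms] by force
  ultimately show ?thesis
    using assms by (metis inner_commute sym_pos_def_def)
qed

lemma sym_pos_def_Cauchy_Schwarz:
  assumes "sym_pos_def V"
  shows "y \<bullet> x \<le> sqrt (y \<bullet> (matrix_inv V *v y)) * sqrt (x \<bullet> (V *v x))"
proof -
  define u where "u = matrix_inv V *v y"
  define a b where "a = u \<bullet> (V *v u)" and "b = x \<bullet> (V *v x)"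
  have Vu: "V *v u = y" unfolding u_def by (rule sym_pos_def_mult_matrix_inv[OF assms])
  have c: "u \<bullet> (V *v x) = y \<bullet> x"
    using sym_pos_def_inner_commute[OF assms, of u x] by (simp add: Vu inner_commute)
  have ab: "0 \<le> a" "0 \<le> b" unfolding a_def b_def by (rule sym_pos_def_nonneg[OF assms])+
  define s t where "s = sqrt a" and "t = sqrt b"
  have st: "s\<^sup>2 = a" "t\<^sup>2 = b" "0 \<le> s" "0 \<le> t" using ab by (simp_all add: s_def t_def)
  have "y \<bullet> x \<le> s * t"
  \<comment> \<open>If one vector vanishes, so does \<open>y \<bullet> x\<close>; otherwise
    \<open>s * t\<close> is positive and can be cancelled below.\<close>
  proof (cases "u = 0 \<or> x = 0")
    case True
    then show ?thesis using c st by auto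
  next
    case False
    then have "0 < a" "0 < b" using assms by (auto simp: a_def b_def sym_pos_def_def)
    then have pos: "0 < s * t" by (simp add: s_def t_def)
    \<comment> \<open>Here \<open>s\<close> and \<open>t\<close> are the \<open>V\<close>-norms of
      \<open>u\<close> and \<open>x\<close>, so both scaled vectors have \<open>V\<close>-norm
      \<open>s * t\<close> and the expansion factors.\<close>
    have "0 \<le> (t *\<^sub>R u - s *\<^sub>R x) \<bullet> (V *v (t *\<^sub>R u - s *\<^sub>R x))"
      by (rule sym_pos_def_nonneg[OF assms])
    also have "\<dots> = t\<^sup>2 * a - 2 * (s * t) * (y \<bullet> x) + s\<^sup>2 * b"
      using c by (simp add: matrix_vector_mult_diff_distrib matrix_vector_mult_scaleR Vu a_def b_def
          inner_diff_left inner_diff_right inner_commute power2_eq_square algebra_simps)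
    also have "\<dots> = 2 * (s * t) * (s * t - y \<bullet> x)"
      unfolding st(1,2)[symmetric] by (simp add: power2_eq_square algebra_simps)
    finally show ?thesis using pos by (simp add: zero_le_mult_iff)
  qed
  then show ?thesis
    by (simp add: s_def t_def a_def b_def Vu inner_commute flip: u_def)
qed

lemma q_tilde_feasible:
  assumes "w \<in> feasible V \<sigma>"
  shows "q_tilde V w = - (1/2) * \<sigma>\<^sup>2 + (diag_vec V \<bullet> risky_part w) / 2"
  using assms by (simp add: q_tilde_eq feasible_def field_simps)

text \<open>The sign of \<open>\<sigma>\<close> enters through
  \<open>sqrt (\<sigma>\<^sup>2) = \<sigma>\<close>.\<close>

lemma q_tilde_le:
  assumes "sym_pos_def V" "0 \<le> \<sigma>" "w \<in> feasible V \<sigma>"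
  shows "q_tilde V w \<le> - (1/2) * \<sigma>\<^sup>2
           + \<sigma> / 2 * sqrt (diag_vec V \<bullet> (matrix_inv V *v diag_vec V))"
  using sym_pos_def_Cauchy_Schwarz[OF assms(1), of "diag_vec V" "risky_part w"] assms(2,3)
  by (simp add: q_tilde_feasible feasible_def mult.commute)

text \<open>Equality in Cauchy-Schwarz forces the risky part to be parallel to
  \<open>matrix_inv V *v diag_vec V\<close>; the variance constraint fixes the scale.\<close>

lemma q_tilde_attained:
  fixes V :: "real^'n^'n"
  assumes "sym_pos_def V"
  shows "\<exists>w\<in>feasible V \<sigma>. q_tilde V w = - (1/2) * \<sigma>\<^sup>2
           + \<sigma> / 2 * sqrt (diag_vec V \<bullet> (matrix_inv V *v diag_vec V))"
proof -
  define u where "u = matrix_inv V *v diag_vec V"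
  define k where "k = diag_vec V \<bullet> u"
  have Vu: "V *v u = diag_vec V" unfolding u_def by (rule sym_pos_def_mult_matrix_inv[OF assms])
  have k: "0 < k" using matrix_inv_diag_pos[OF assms] by (simp add: k_def u_def)
  \<comment> \<open>Since \<open>u \<bullet> (V *v u) = k\<close>, this scaling gives
    \<open>x\<close> the variance \<open>\<sigma>\<^sup>2\<close>.\<close>
  define x where "x = (\<sigma> / sqrt k) *\<^sub>R u"
  \<comment> \<open>The risk-free weight absorbs whatever the risky weights leave of the
    budget.\<close>
  define w :: "real^('n option)"
    where "w = (\<chi> i. case i of None \<Rightarrow> 1 - 1 \<bullet> x | Some j \<Rightarrow> x $ j)"
  have rx: "risky_part w = x" by (simp add: w_def risky_part_def vec_eq_iff)
  have "x \<bullet> (V *v x) = (\<sigma> / sqrt k)\<^sup>2 * k"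
    by (simp add: x_def matrix_vector_mult_scaleR Vu k_def inner_commute power2_eq_square)
  also have "\<dots> = \<sigma>\<^sup>2" using k by (simp add: power_divide)
  finally have feas: "w \<in> feasible V \<sigma>"
    \<comment> \<open>Only the component at \<open>None\<close> is unfolded, so that
      \<open>risky_part w\<close> stays intact for \<open>rx\<close>.\<close>
    by (simp add: feasible_def one_inner_option rx w_def[THEN arg_cong[of _ _ "\<lambda>v. v $ None"]])
  have "diag_vec V \<bullet> x = \<sigma> * (k / sqrt k)" by (simp add: x_def k_def)
  also have "\<dots> = \<sigma> * sqrt k" using k by (simp add: real_div_sqrt)
  finally have "q_tilde V w = - (1/2) * \<sigma>\<^sup>2 + \<sigma> / 2 * sqrt k"
    using q_tilde_feasible[OF feas] by (simp add: rx)
  then show ?thesis using feas by (auto simp: k_def u_def)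
qed

theorem mainTheorem6:
  fixes V :: "real^'n^'n"
  assumes "sym_pos_def V"
  shows "(\<forall>\<sigma>\<ge>0. (\<exists>w. is_maximiser V \<sigma> w) \<and>
            q_dr V \<sigma> = - (1/2) * \<sigma>\<^sup>2
              + \<sigma> / 2 * sqrt (diag_vec V \<bullet> (matrix_inv V *v diag_vec V)))
         \<and> is_parabola_over_nonneg (dr_frontier V)
         \<and> strongly_concave_on {0..} (q_dr V)"
proof -
  define r where "r = sqrt (diag_vec V \<bullet> (matrix_inv V *v diag_vec V))"
  have main: "(\<exists>w. is_maximiser V \<sigma> w) \<and> q_dr V \<sigma> = - (1/2) * \<sigma>\<^sup>2 + \<sigma> / 2 * r"
    if "0 \<le> \<sigma>" for \<sigma>
  proof -
    obtain w where w: "w \<in> feasible V \<sigma>" "q_tilde V w = - (1/2) * \<sigma>\<^sup>2 + \<sigma> / 2 * r"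
      using q_tilde_attained[OF assms] unfolding r_def by blast
    have le: "q_tilde V u \<le> q_tilde V w" if "u \<in> feasible V \<sigma>" for u
      using q_tilde_le[OF assms \<open>0 \<le> \<sigma>\<close> that] w(2) by (simp add: r_def)
    have "is_maximiser V \<sigma> w" using w(1) le by (simp add: is_maximiser_def)
    moreover have "q_dr V \<sigma> = q_tilde V w"
      \<comment> \<open>An attained upper bound is the supremum, so \<open>q_dr\<close> is a true
        optimal value here.\<close>
      unfolding q_dr_def by (rule cSup_eq_maximum) (use w(1) le in auto)
    ultimately show ?thesis using w(2) by auto
  qed
  have "dr_frontier V = {(x, - (1/2) * x\<^sup>2 + r / 2 * x + 0) | x. x \<ge> 0}"
    unfolding dr_frontier_def using main by (force simp: mult.commute)
  then have "is_parabola_over_nonneg (dr_frontier V)"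
    unfolding is_parabola_over_nonneg_def
    by (intro exI[of _ "- (1/2)"] exI[of _ "r/2"] exI[of _ 0]) simp
  \<comment> \<open>The modulus 1 cancels the quadratic term exactly. What remains is linear on the
    half-line, so the concavity inequality holds with equality.\<close>
  moreover have "concave_on {0..} (\<lambda>x. q_dr V x + 1 / 2 * x\<^sup>2)"
  proof -
    have lin: "q_dr V x + 1 / 2 * x\<^sup>2 = x / 2 * r" if "0 \<le> x" for x
      using main[OF that] by simp
    show ?thesis
      unfolding concave_on_iff
    proof (intro conjI ballI allI impI)
      fix x y u v :: real
      assume "x \<in> {0..}" "y \<in> {0..}" "0 \<le> u" "0 \<le> v" "u + v = 1"
      \<comment> \<open>The closed form is known only for nonnegative arguments, so the convex
        combination must be checked as well.\<close>
      then have nonneg: "0 \<le> x" "0 \<le> y" "0 \<le> u *\<^sub>R x + v *\<^sub>R y" by auto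
      show "u * (q_dr V x + 1 / 2 * x\<^sup>2) + v * (q_dr V y + 1 / 2 * y\<^sup>2)
          \<le> q_dr V (u *\<^sub>R x + v *\<^sub>R y) + 1 / 2 * (u *\<^sub>R x + v *\<^sub>R y)\<^sup>2"
        unfolding lin[OF nonneg(1)] lin[OF nonneg(2)] lin[OF nonneg(3)]
        by (simp add: algebra_simps add_divide_distrib)
    qed (rule convex_real_interval)
  qed
  then have "strongly_concave_on {0..} (q_dr V)"
    unfolding strongly_concave_on_def by (intro exI[of _ 1]) simp
  ultimately show ?thesis using main by (simp add: r_def)
qed

end
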